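(* Let $m$ and $n$ be odd positive integers with $m\le n\le \frac{1}{2}(m^2-3m+2)$. Then the queen graph $Q_{m,n}$ is class 1, i.e., $\chi'(Q_{m,n})=\Delta(Q_{m,n})$.
   Context: The queen graph $Q_{m,n}$ has as vertices the cells of an $m\times n$ grid, two distinct cells being adjacent iff they lie in the same row, the same column, or on the same diagonal or anti-diagonal. A graph is class 1 if its edge-chromatic number equals its maximum degree. (For odd $m\le n$ with $m<n$, $\Delta(Q_{m,n})=3m+n-4$.) *)

theory Defs
  imports Complex_Main
begin

(* A finite simple graph is given by its vertex set V and its edge set E of
   two-element subsets of V. *)

definition vertex_degree :: "'a set set \<Rightarrow> 'a \<Rightarrow> nat" where
  "vertex_degree E v = card {e \<in> E. v \<in> e}"

definition max_degree :: "'a set \<Rightarrow> 'a set set \<Rightarrow> nat" where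
  "max_degree V E = Max (vertex_degree E ` V)"

definition proper_edge_colouring :: "'a set set \<Rightarrow> ('a set \<Rightarrow> nat) \<Rightarrow> bool" where
  "proper_edge_colouring E c \<longleftrightarrow>
     (\<forall>e\<in>E. \<forall>f\<in>E. e \<noteq> f \<and> e \<inter> f \<noteq> {} \<longrightarrow> c e \<noteq> c f)"

(* For finite E the minimum exists, since an injective colouring is proper. *)
definition edge_chromatic_number :: "'a set set \<Rightarrow> nat" where
  "edge_chromatic_number E =
     (LEAST k. \<exists>c. proper_edge_colouring E c \<and> c ` E \<subseteq> {..<k})"

definition class_1 :: "'a set \<Rightarrow> 'a set set \<Rightarrow> bool" where
  "class_1 V E \<longleftrightarrow> edge_chromatic_number E = max_degree V E"

(* The pair (i, j) is the cell in row i and column j; rows and columns are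
   numbered from 0. *)
definition queen_cells :: "nat \<Rightarrow> nat \<Rightarrow> (nat \<times> nat) set" where
  "queen_cells m n = {..<m} \<times> {..<n}"

(* Differences are taken in int, as subtraction on nat truncates. *)
definition queen_adj :: "nat \<times> nat \<Rightarrow> nat \<times> nat \<Rightarrow> bool" where
  "queen_adj u v \<longleftrightarrow> u \<noteq> v \<and>
     (fst u = fst v \<or> snd u = snd v \<or>
      int (fst u) - int (snd u) = int (fst v) - int (snd v) \<or>
      fst u + snd u = fst v + snd v)"

definition queen_edges :: "nat \<Rightarrow> nat \<Rightarrow> (nat \<times> nat) set set" where
  "queen_edges m n =
     {{u, v} | u v. u \<in> queen_cells m n \<and> v \<in> queen_cells m n \<and> queen_adj u v}"

end

theory Submission
  imports Defs "HOL-Number_Theory.Cong"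
begin

text \<open>
  Write \<open>m = 2 D + 1\<close> and \<open>n = 2 N + 1\<close>. The centre has degree \<open>3 m + n - 4\<close>, so it suffices to
  colour the edges by \<open>m + n - 2\<close> rook colours and \<open>2 (m - 1)\<close> bishop colours.

  Bishop moves. For each \<open>d = 1, ..., D\<close> and each sense (right or left) move cyclically from row
  \<open>i\<close> to row \<open>i + d\<close> modulo \<open>m\<close>, along a diagonal, always in this sense. The column is monotone
  along such a walk, so the moves form disjoint paths, which two colours suffice to colour
  alternately. All paths can be started with the same colour; then the other colour is free at
  every cell in which a path starts.

  Rook moves. These do not fit into \<open>m + n - 2\<close> colours; one has to leave \<open>(m + n - 2) / 2\<close> edges
  uncoloured, and these are arranged to be a matching on path starts, so that they can take the
  free bishop colours. The columns other than the last one are paired, and each pair is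
  attached to a row. A row is coloured like the complete graph on the integers modulo \<open>n\<close>, where
  \<open>{x, y}\<close> is coloured by \<open>(x + y) / 2\<close> and the paired columns are \<open>p\<close> and \<open>- p\<close>. The edge
  \<open>{p, - p}\<close> takes a vertical colour, except in the row attached to the pair; there it is coloured
  at the expense of an edge \<open>{p, - 3 p}\<close> or \<open>{- 3 p, 5 p}\<close>, which becomes the uncoloured one. The
  identification of columns with residues may vary from row to row, so the uncoloured edges can
  be moved into the leftmost \<open>D\<close> columns.
\<close>

section \<open>Class 1 graphs and the degree of the centre\<close>

lemma vertex_degree_le_colours:
  assumes "proper_edge_colouring E c" and "c ` E \<subseteq> {..<k}"
  shows "vertex_degree E v \<le> k"
proof -
  have "inj_on c {e \<in> E. v \<in> e}"
    using assms(1) unfolding inj_on_def proper_edge_colouring_def by blast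
  moreover have "c ` {e \<in> E. v \<in> e} \<subseteq> {..<k}"
    using assms(2) by blast
  ultimately have "card {e \<in> E. v \<in> e} \<le> card {..<k}"
    by (intro card_inj_on_le) auto
  then show ?thesis
    by (simp add: vertex_degree_def)
qed

text \<open>Every degree is a lower bound for the number of colours, so a colouring with at most
  \<open>deg v\<close> colours forces the maximum degree and the edge-chromatic number to equal
  \<open>k\<close>.\<close>

lemma class_1_if_coloured:
  assumes "finite V" and "v \<in> V" and "k \<le> vertex_degree E v"
    and "proper_edge_colouring E c" and "c ` E \<subseteq> {..<k}"
  shows "class_1 V E"
proof -
  let ?P = "\<lambda>k. \<exists>c. proper_edge_colouring E c \<and> c ` E \<subseteq> {..<k}"
  have Pk: "?P k" using assms by blast
  have deg: "vertex_degree E u \<le> l" if "?P l" for u l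
    using that by (auto dest: vertex_degree_le_colours)
  have "Max (vertex_degree E ` V) = k"
  proof (rule Max_eqI)
    show "k \<in> vertex_degree E ` V"
      using deg[OF Pk, of v] assms(2,3) by (intro image_eqI[of _ _ v]) auto
  qed (use assms(1) deg[OF Pk] in auto)
  moreover have "(LEAST k. ?P k) = k"
  proof (rule Least_equality)
    show "k \<le> l" if "?P l" for l
      using deg[OF that, of v] assms(3) by linarith
  qed (rule Pk)
  ultimately show ?thesis
    by (simp add: class_1_def edge_chromatic_number_def max_degree_def)
qed

text \<open>Allows colours to be given on ordered pairs with values in a structured palette:
  symmetry makes them descend to edges, and a bijection numbers the palette.\<close>

lemma proper_edge_colouring_from_symmetric:
  fixes f :: "'a \<Rightarrow> 'a \<Rightarrow> 'b"
  assumes pairs: "\<And>e. e \<in> E \<Longrightarrow> \<exists>u v. e = {u, v}"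
    and sym: "\<And>u v. {u, v} \<in> E \<Longrightarrow> f u v = f v u"
    and proper: "\<And>u v w. {u, v} \<in> E \<Longrightarrow> {u, w} \<in> E \<Longrightarrow> f u v = f u w \<Longrightarrow> v = w"
    and palette: "\<And>u v. {u, v} \<in> E \<Longrightarrow> f u v \<in> C" and "finite C"
  obtains c where "proper_edge_colouring E c" and "c ` E \<subseteq> {..<card C}"
proof -
  obtain num where num: "bij_betw num C {..<card C}"
    using ex_bij_betw_finite_nat[OF \<open>finite C\<close>] by (auto simp: atLeast0LessThan)
  have "\<exists>x. \<forall>u v. e = {u, v} \<longrightarrow> f u v = x" if e: "e \<in> E" for e
  proof -
    obtain a b where "e = {a, b}" using pairs[OF e] by blast
    then show ?thesis
      using e sym[of a b] by (intro exI[of _ "f a b"]) (auto simp: doubleton_eq_iff)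
  qed
  then obtain g where g: "\<And>u v. {u, v} \<in> E \<Longrightarrow> f u v = g {u, v}"
    by metis
  have gC: "g e \<in> C" if "e \<in> E" for e
    using pairs[of e] g palette that by metis
  have "num (g e) \<noteq> num (g e')" if e: "e \<in> E" "e' \<in> E" "e \<noteq> e'" "e \<inter> e' \<noteq> {}" for e e'
  proof -
    obtain u where u: "u \<in> e" "u \<in> e'" using e(4) by blast
    obtain v where v: "e = {u, v}" using pairs[OF e(1)] u(1) by blast
    obtain w where w: "e' = {u, w}" using pairs[OF e(2)] u(2) by blast
    have "g e \<noteq> g e'"
      using g[of u v] g[of u w] proper[of u v w] e(1-3) unfolding v w by auto
    then show ?thesis
      using num gC[OF e(1)] gC[OF e(2)] by (metis bij_betw_def inj_on_eq_iff)
  qed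
  then have "proper_edge_colouring E (num \<circ> g)"
    by (auto simp: proper_edge_colouring_def)
  moreover have "(num \<circ> g) ` E \<subseteq> {..<card C}"
    using num gC by (auto simp: bij_betw_def)
  ultimately show thesis by (rule that)
qed

lemma queen_edge_iff:
  "{u, v} \<in> queen_edges m n \<longleftrightarrow> u \<in> queen_cells m n \<and> v \<in> queen_cells m n \<and> queen_adj u v"
proof
  assume "{u, v} \<in> queen_edges m n"
  then obtain a b where ab: "{u, v} = {a, b}" "a \<in> queen_cells m n" "b \<in> queen_cells m n"
      "queen_adj a b"
    by (auto simp: queen_edges_def)
  have "queen_adj b a" using ab(4) by (auto simp: queen_adj_def)
  then show "u \<in> queen_cells m n \<and> v \<in> queen_cells m n \<and> queen_adj u v"
    using ab by (auto simp: doubleton_eq_iff)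
qed (unfold queen_edges_def, blast)

text \<open>\<open>(D, D)\<close> is the centre of the leftmost \<open>m\<close> by \<open>m\<close>
  square, so both diagonals through it meet every row: it has \<open>n - 1\<close> neighbours in its
  row and \<open>m - 1\<close> on each of the other three lines.\<close>

lemma queen_degree_centre:
  assumes "m = 2 * D + 1" and "m \<le> n"
  shows "3 * m + n - 4 \<le> vertex_degree (queen_edges m n) (D, D)"
proof -
  let ?c = "(D, D)"
  define R where "R = Pair D ` ({..<n} - {D})"
  define K where "K = (\<lambda>i. (i, D)) ` ({..<m} - {D})"
  define G where "G = (\<lambda>i. (i, i)) ` ({..<m} - {D})"
  define A where "A = (\<lambda>i. (i, 2 * D - i)) ` ({..<m} - {D})"
  define S where "S = R \<union> (K \<union> (G \<union> A))"
  have fin: "finite R" "finite K" "finite G" "finite A"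
    by (simp_all add: R_def K_def G_def A_def)
  have cards: "card R = n - 1" "card K = m - 1" "card G = m - 1" "card A = m - 1"
  proof -
    have "inj_on (\<lambda>i. (i, a i)) B" for a :: "nat \<Rightarrow> nat" and B
      by (simp add: inj_on_def)
    then have "card ((\<lambda>i. (i, a i)) ` ({..<m} - {D})) = m - 1" for a :: "nat \<Rightarrow> nat"
      using assms(1) by (simp add: card_image)
    then show "card K = m - 1" "card G = m - 1" "card A = m - 1"
      by (simp_all add: K_def G_def A_def)
    have "card ({..<n} - {D}) = n - 1" using assms by simp
    then show "card R = n - 1"
      unfolding R_def by (subst card_image) (simp_all add: inj_on_def)
  qed
  have disj: "G \<inter> A = {}" "K \<inter> (G \<union> A) = {}" "R \<inter> (K \<union> (G \<union> A)) = {}"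
    using assms(1) unfolding R_def K_def G_def A_def by auto
  have "card S = (n - 1) + ((m - 1) + ((m - 1) + (m - 1)))"
    unfolding S_def by (simp add: card_Un_disjoint fin cards disj)
  then have cardS: "card S = 3 * m + n - 4"
    using assms by simp
  have S: "{?c, u} \<in> queen_edges m n \<and> u \<noteq> ?c" if "u \<in> S" for u
    using that assms
    by (auto simp: S_def R_def K_def G_def A_def queen_edge_iff queen_cells_def queen_adj_def)
  have "finite (queen_edges m n)"
  proof (rule finite_subset)
    show "queen_edges m n \<subseteq> Pow (queen_cells m n)"
      by (auto simp: queen_edges_def)
  qed (simp add: queen_cells_def)
  then have "card ((\<lambda>u. {?c, u}) ` S) \<le> card {e \<in> queen_edges m n. ?c \<in> e}"
    using S by (intro card_mono) auto
  moreover have "inj_on (\<lambda>u. {?c, u}) S"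
    by (auto simp: inj_on_def doubleton_eq_iff)
  ultimately show ?thesis
    by (simp add: card_image vertex_degree_def cardS)
qed

section \<open>Colouring a single row\<close>

text \<open>
  \<open>Hue q\<close> is the rook colour named after column \<open>q\<close>, which vertical edges of column \<open>q\<close> use as
  well; \<open>Partner\<close> stands for a vertical colour depending on the row; \<open>Spare\<close> marks the edges
  handed over to the bishop colours.
\<close>

datatype line_colour = Hue nat | Partner | Spare

section \<open>Labelling columns by residues, with opposite labels on paired columns\<close>

lemma extend_injection:
  assumes "finite X" "A \<subseteq> X" "inj_on f A" "f ` A \<subseteq> Y" "finite Y" "card X \<le> card Y"
  obtains g where "inj_on g X" "g ` X \<subseteq> Y" "\<And>x. x \<in> A \<Longrightarrow> g x = f x"
proof -
  have finA: "finite A" using assms finite_subset by blast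
  have "card (X - A) \<le> card (Y - f ` A)"
    using assms finA by (simp add: card_Diff_subset card_image)
  then obtain h where h: "h ` (X - A) \<subseteq> Y - f ` A" "inj_on h (X - A)"
    using card_le_inj[of "X - A" "Y - f ` A"] assms by auto
  define g where "g x = (if x \<in> A then f x else h x)" for x
  have "inj_on g X"
    using assms(3) h unfolding inj_on_def g_def by (auto split: if_splits)
  moreover have "g ` X \<subseteq> Y"
    using assms h by (auto simp: g_def)
  ultimately show thesis
    by (intro that[of g]) (auto simp: g_def)
qed

text \<open>
  Column \<open>x + N\<close> is the partner of column \<open>x\<close> for \<open>x < N\<close>, and \<open>2 * N\<close> is the unpaired last column.
\<close>

lemma signed_labelling_extends:
  fixes N :: nat and g :: "nat \<Rightarrow> int"
  defines "n \<equiv> 2 * int N + 1"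
  assumes A: "A \<subseteq> {..<N}"
    and nonzero: "\<And>x. x \<in> A \<Longrightarrow> \<not> [g x = 0] (mod n)"
    and distinct: "\<And>x y. x \<in> A \<Longrightarrow> y \<in> A \<Longrightarrow> [g x = g y] (mod n) \<or> [g x = - g y] (mod n) \<Longrightarrow> x = y"
  obtains \<theta> where "\<And>x. x \<in> A \<Longrightarrow> \<theta> x = g x" "\<And>x. x < N \<Longrightarrow> \<theta> (x + N) = - \<theta> x" "\<theta> (2 * N) = (0 :: int)"
    "\<And>x y. x \<le> 2 * N \<Longrightarrow> y \<le> 2 * N \<Longrightarrow> [\<theta> x = \<theta> y] (mod n) \<Longrightarrow> x = y"
proof -
  \<comment> \<open>The distance from \<open>z\<close> to the nearest multiple of \<open>n\<close>:
    a number in \<open>{0..N}\<close> that represents the residue up to sign.\<close>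
  define lab where "lab z = (if z mod n \<le> int N then z mod n else n - z mod n)" for z
  have n: "n > 0" by (simp add: n_def)
  have lab0: "lab z = 0 \<longleftrightarrow> [z = 0] (mod n)" for z
    using pos_mod_bound[OF n, of z] by (simp add: lab_def cong_def)
  have lab_range: "0 \<le> lab z \<and> lab z \<le> int N" for z
    using n pos_mod_bound[OF n, of z] pos_mod_sign[OF n, of z] by (auto simp: lab_def n_def)
  have minus: "(- z) mod n = (if z mod n = 0 then 0 else n - z mod n)" for z
    by (simp add: zmod_zminus1_eq_if)
  have lab_uminus: "lab (- z) = lab z" for z
    unfolding lab_def minus
    using pos_mod_bound[OF n, of z] pos_mod_sign[OF n, of z] n_def by auto
  have lab_cong: "[y = z] (mod n) \<or> [y = - z] (mod n)" if "lab y = lab z" for y z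
    using that pos_mod_bound[OF n, of z] pos_mod_bound[OF n, of y]
    by (auto simp: lab_def cong_def minus split: if_splits)
  have cong_lab: "lab y = lab z" if "[y = z] (mod n)" for y z
    using that by (simp add: lab_def cong_def)
  have "inj_on (\<lambda>x. lab (g x)) A"
    using distinct lab_cong by (intro inj_onI) blast
  moreover have "(\<lambda>x. lab (g x)) ` A \<subseteq> {1..int N}"
  proof (rule image_subsetI)
    fix x assume "x \<in> A"
    then show "lab (g x) \<in> {1..int N}"
      using lab_range[of "g x"] nonzero[of x] lab0[of "g x"] by auto
  qed
  ultimately obtain h where h: "inj_on h {..<N}" "h ` {..<N} \<subseteq> {1..int N}"
      "\<And>x. x \<in> A \<Longrightarrow> h x = lab (g x)"
    using extend_injection[of "{..<N}" A "\<lambda>x. lab (g x)" "{1..int N}"] A by auto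
  \<comment> \<open>The injection \<open>h\<close> fixes labels only up to sign; on \<open>A\<close>
    the prescribed sign of \<open>g\<close> is kept.\<close>
  define t where "t x = (if x \<in> A then g x else h x)" for x
  define \<theta> where "\<theta> x = (if x < N then t x else if x < 2 * N then - t (x - N) else 0)" for x
  have lab_t: "lab (t x) = h x" if "x < N" for x
    using h that by (force simp: t_def lab_def n_def)
  have h_pos: "h x > 0" if "x < N" for x
    using h(2) that by force
  define l where "l x = (if x < N then x else x - N)" for x
  have lab_\<theta>: "lab (\<theta> x) = (if x < 2 * N then h (l x) else 0)" if "x \<le> 2 * N" for x
    using that by (auto simp: \<theta>_def l_def lab_t lab_uminus lab0)
  \<comment> \<open>Oddness of \<open>n\<close> keeps the labels of a column and its partner
    apart.\<close>
  have no_sign: "\<not> [t x = - t x] (mod n)" if "x < N" for x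
  proof
    assume "[t x = - t x] (mod n)"
    then have "n dvd 2 * t x"
      by (simp add: cong_iff_dvd_diff)
    moreover have "coprime n 2" by (simp add: n_def)
    ultimately have "[t x = 0] (mod n)"
      by (simp add: coprime_dvd_mult_right_iff cong_0_iff)
    then have "lab (t x) = 0" using lab0 by blast
    then show False using lab_t[OF that] h_pos[OF that] by simp
  qed
  have "x = y" if xy: "x \<le> 2 * N" "y \<le> 2 * N" "[\<theta> x = \<theta> y] (mod n)" for x y
  proof -
    have eq: "lab (\<theta> x) = lab (\<theta> y)" by (rule cong_lab[OF xy(3)])
    have l: "l z < N" if "z < 2 * N" for z using that by (auto simp: l_def)
    show ?thesis
    proof (cases "x < 2 * N")
      case True
      with eq lab_\<theta>[OF xy(1)] lab_\<theta>[OF xy(2)] h_pos[OF l[OF True]]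
      have y: "y < 2 * N" "h (l x) = h (l y)" by (auto split: if_splits)
      then have "l x = l y" using h(1) l[OF True] l[OF y(1)] by (auto dest: inj_onD)
      moreover have "\<not> [\<theta> (l x) = - \<theta> (l x)] (mod n)"
        using no_sign[OF l[OF True]] l[OF True] by (simp add: \<theta>_def)
      moreover have "\<not> [- \<theta> (l x) = \<theta> (l x)] (mod n)"
        using calculation(2) cong_sym by blast
      ultimately show ?thesis
        using True y(1) xy(3) by (auto simp: l_def \<theta>_def split: if_splits)
    next
      case False
      then show ?thesis
        using eq lab_\<theta>[OF xy(1)] lab_\<theta>[OF xy(2)] h_pos[OF l] xy by (force split: if_splits)
    qed
  qed
  moreover have "\<theta> x = g x" if "x \<in> A" for x
    using that A by (auto simp: \<theta>_def t_def)
  ultimately show thesis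
    by (intro that[of \<theta>]) (auto simp: \<theta>_def)
qed

text \<open>
  For \<open>p\<close> in \<open>P\<close> the colours are shifted along the alternating path through \<open>- p, p, - 3 p, 5 p\<close>,
  as far as its third or its second edge; \<open>w p = p\<close> encodes the latter choice.
\<close>

lemma line_colouring_from_labelling:
  fixes N :: nat and \<theta> :: "nat \<Rightarrow> int"
  defines "n \<equiv> 2 * int N + 1"
  assumes anti: "\<And>x. x < N \<Longrightarrow> \<theta> (x + N) = - \<theta> x" and zero: "\<theta> (2 * N) = 0"
    and inj: "\<And>x y. x \<le> 2 * N \<Longrightarrow> y \<le> 2 * N \<Longrightarrow> [\<theta> x = \<theta> y] (mod n) \<Longrightarrow> x = y"
    and P: "P \<subseteq> {..<N}"
    and y: "\<And>p. p \<in> P \<Longrightarrow> y p \<le> 2 * N \<and> [\<theta> (y p) = - 3 * \<theta> p] (mod n)"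
    and w: "\<And>p. p \<in> P \<Longrightarrow> w p \<le> 2 * N \<and> (w p = p \<or> [\<theta> (w p) = 5 * \<theta> p] (mod n))"
  obtains \<kappa> where "\<And>x y. \<kappa> x y = \<kappa> y x"
    "\<And>x a b c. \<lbrakk>x \<le> 2 * N; a \<le> 2 * N; b \<le> 2 * N; x \<noteq> a; x \<noteq> b; \<kappa> x a = Hue c; \<kappa> x b = Hue c\<rbrakk> \<Longrightarrow> a = b"
    "\<And>x a. \<lbrakk>x \<le> 2 * N; a \<le> 2 * N; x \<noteq> a; \<kappa> x a = Hue x\<rbrakk> \<Longrightarrow> \<exists>p\<in>P. x = p \<or> x = p + N"
    "\<And>x a. \<lbrakk>x \<le> 2 * N; a \<le> 2 * N; x \<noteq> a; \<kappa> x a = Partner\<rbrakk> \<Longrightarrow> \<exists>p. p < N \<and> p \<notin> P \<and> {x, a} = {p, p + N}"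
    "\<And>x a. \<lbrakk>x \<le> 2 * N; a \<le> 2 * N; x \<noteq> a; \<kappa> x a = Spare\<rbrakk> \<Longrightarrow> \<exists>p\<in>P. {x, a} = {y p, w p}"
    "\<And>x a c. \<lbrakk>x \<le> 2 * N; a \<le> 2 * N; x \<noteq> a; \<kappa> x a = Hue c\<rbrakk> \<Longrightarrow> c < 2 * N"
proof -
  have n: "n > 0" and odd_n: "coprime n 2" by (simp_all add: n_def)
  have half: "[u = v] (mod n)" if "[2 * u = 2 * v] (mod n)" for u v
    using that odd_n by (meson cong_mult_lcancel coprime_commute)
  have surj: "\<exists>q\<le>2 * N. [2 * \<theta> q = z] (mod n)" for z
  proof -
    have "inj_on (\<lambda>q. (2 * \<theta> q) mod n) {..2 * N}"
    proof (rule inj_onI)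
      fix u v assume "u \<in> {..2 * N}" "v \<in> {..2 * N}" "(2 * \<theta> u) mod n = (2 * \<theta> v) mod n"
      then show "u = v" using inj[of u v] half[of "\<theta> u" "\<theta> v"] by (simp add: cong_def)
    qed
    moreover have "(\<lambda>q. (2 * \<theta> q) mod n) ` {..2 * N} \<subseteq> {0..<n}"
      using n by auto
    moreover have "card {..2 * N} = card {0..<n}"
      by (simp add: n_def)
    ultimately have "(\<lambda>q. (2 * \<theta> q) mod n) ` {..2 * N} = {0..<n}"
      by (intro card_subset_eq) (simp_all add: card_image)
    moreover have "z mod n \<in> {0..<n}" using n by simp
    ultimately have "z mod n \<in> (\<lambda>q. (2 * \<theta> q) mod n) ` {..2 * N}" by blast
    then show ?thesis
      by (auto simp: cong_def)
  qed
  \<comment> \<open>The column whose label is the midpoint of two labels. This is the standard edge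
    colouring of the complete graph on an odd number of vertices, in which column \<open>q\<close>
    misses exactly colour \<open>q\<close>.\<close>
  define \<mu> where "\<mu> x a = (SOME q. q \<le> 2 * N \<and> [2 * \<theta> q = \<theta> x + \<theta> a] (mod n))" for x a
  have \<mu>: "\<mu> x a \<le> 2 * N" "[2 * \<theta> (\<mu> x a) = \<theta> x + \<theta> a] (mod n)" for x a
    using someI_ex[OF surj[of "\<theta> x + \<theta> a"]] by (simp_all add: \<mu>_def)
  have \<mu>_sym: "\<mu> x a = \<mu> a x" for x a
    by (simp add: \<mu>_def add.commute)
  have \<mu>_value: "[\<theta> a = 2 * \<theta> q - \<theta> x] (mod n)" if "\<mu> x a = q" for x a q
    using \<mu>(2)[of x a] that by (simp add: cong_iff_dvd_diff algebra_simps dvd_diff_commute)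
  have \<mu>_inj: "a = b" if "a \<le> 2 * N" "b \<le> 2 * N" "\<mu> x a = \<mu> x b" for x a b
    using \<mu>_value[of x a] \<mu>_value[of x b] that inj by (metis cong_sym cong_trans)
  have \<mu>_self: "a = x" if "a \<le> 2 * N" "x \<le> 2 * N" "\<mu> x a = x" for x a
    using \<mu>_value[OF that(3)] that inj by simp
  define \<kappa> where "\<kappa> x a = (let q = \<mu> x a in
      if q = 2 * N then (if min x a \<in> P then Hue (min x a + N) else Partner)
      else if q < N then (if q \<in> P \<and> {x, a} = {y q, w q} then Spare else Hue q)
      else if q - N \<in> P \<and> {x, a} = {q - N, y (q - N)}
        then (if w (q - N) = q - N then Spare else Hue (q - N)) else Hue q)" for x a
  have zero_sum: "\<exists>p<N. min x a = p \<and> {x, a} = {p, p + N}"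
    if x: "x \<le> 2 * N" "a \<le> 2 * N" "x \<noteq> a" "\<mu> x a = 2 * N" for x a
  proof -
    have *: "[\<theta> a = - \<theta> x] (mod n)"
      using \<mu>_value[OF x(4)] zero by simp
    have eqI: "a = z" if "z \<le> 2 * N" "\<theta> z = - \<theta> x" for z
      using inj[of a z] * that \<open>a \<le> 2 * N\<close> by simp
    consider "x < N" | "x = 2 * N" | "N \<le> x" "x < 2 * N"
      using x(1) by linarith
    then show ?thesis
    proof cases
      case 1
      then have "a = x + N" using eqI[of "x + N"] anti[of x] by simp
      then show ?thesis using 1 by auto
    next
      case 2
      then have "a = x" using eqI[of x] zero by simp
      then show ?thesis using x(3) by simp
    next
      case 3
      then have "a = x - N" using eqI[of "x - N"] anti[of "x - N"] by simp
      then show ?thesis using 3 by (intro exI[of _ a]) auto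
    qed
  qed
  \<comment> \<open>An edge gets its hue from its midpoint, as the first edge of a path, or as the
    second edge of a path.\<close>
  have hue: "(\<mu> x a = c \<and> c < 2 * N \<and> (c \<in> P \<longrightarrow> {x, a} \<noteq> {y c, w c}) \<and> (\<forall>p\<in>P. c = p + N \<longrightarrow> {x, a} \<noteq> {p, y p}))
      \<or> (\<mu> x a = 2 * N \<and> (\<exists>p\<in>P. c = p + N \<and> {x, a} = {p, p + N}))
      \<or> (c \<in> P \<and> \<mu> x a = c + N \<and> w c \<noteq> c \<and> {x, a} = {c, y c})"
    if "x \<le> 2 * N" "a \<le> 2 * N" "x \<noteq> a" "\<kappa> x a = Hue c" for x a c
  proof -
    consider "\<mu> x a = 2 * N" | "\<mu> x a < N" | "N \<le> \<mu> x a" "\<mu> x a < 2 * N"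
      using \<mu>(1)[of x a] by linarith
    then show ?thesis
    proof cases
      case 1
      then show ?thesis using that zero_sum[OF that(1-3) 1] by (auto simp: \<kappa>_def split: if_splits)
    next
      case 2
      then show ?thesis using that P by (auto simp: \<kappa>_def Let_def split: if_splits)
    next
      case 3
      define p where "p = \<mu> x a - N"
      have p: "\<mu> x a = p + N" "p < N" using 3 by (simp_all add: p_def)
      have \<kappa>: "\<kappa> x a = (if p \<in> P \<and> {x, a} = {p, y p}
          then (if w p = p then Spare else Hue p) else Hue (p + N))"
        unfolding \<kappa>_def Let_def p(1) using p(2) by simp
      show ?thesis
      proof (cases "p \<in> P \<and> {x, a} = {p, y p}")
        case True
        then have "c = p" "w p \<noteq> p" using \<kappa> that(4) by (simp_all split: if_splits)
        then show ?thesis using True p by simp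
      next
        case False
        have "c = p + N" using \<kappa> that(4) unfolding if_not_P[OF False] by simp
        moreover have "p + N \<notin> P" using P by auto
        ultimately show ?thesis using False p by auto
      qed
    qed
  qed
  have minus: "[\<theta> a = - 3 * \<theta> p] (mod n)" if "\<mu> p a = p + N" "p < N" for a p
    using \<mu>_value[OF that(1)] anti[OF that(2)] by (simp add: algebra_simps)
  have proper: "a = b" if x: "x \<le> 2 * N" "a \<le> 2 * N" "b \<le> 2 * N" "x \<noteq> a" "x \<noteq> b"
    and c: "\<kappa> x a = Hue c" "\<kappa> x b = Hue c" for x a b c
  proof -
    \<comment> \<open>Hue \<open>p + N\<close> may move to \<open>{p, p + N}\<close>: column
      \<open>p + N\<close> missed it, and column \<open>p\<close> met it only on the edge to
      \<open>y p\<close>, which has been recoloured.\<close>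
    have mixed_pair: False
      if "x \<le> 2 * N" "a \<le> 2 * N" "x \<noteq> a" "\<mu> x a = p + N" "p \<in> P" "x \<in> {p, p + N}" "{x, a} \<noteq> {p, y p}" for x a p
    proof (cases "x = p")
      case True
      then have "a = y p"
        using minus[of p a] that y[of p] P inj[of a "y p"] by (metis cong_sym cong_trans lessThan_iff subsetD)
      with True that show False by simp
    next
      case False
      then show False using that \<mu>_self[of a x] by auto
    qed
    \<comment> \<open>Hue \<open>p\<close> may move to \<open>{p, y p}\<close>: column
      \<open>p\<close> missed it, and \<open>y p\<close> met it only on the edge to
      \<open>w p\<close>, which is now spare.\<close>
    have mixed_swap: False
      if "x \<le> 2 * N" "a \<le> 2 * N" "x \<noteq> a" "\<mu> x a = p" "p \<in> P" "w p \<noteq> p" "x \<in> {p, y p}" "{x, a} \<noteq> {y p, w p}" for x a p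
    proof (cases "x = p")
      case True
      then show False using that \<mu>_self[of a x] by auto
    next
      case False
      then have x: "x = y p" using that by simp
      then have "[\<theta> a = 2 * \<theta> p - (- 3 * \<theta> p)] (mod n)"
        using \<mu>_value[OF that(4)] y[OF that(5)] by (meson cong_diff cong_refl cong_trans)
      moreover have "[\<theta> (w p) = 2 * \<theta> p - (- 3 * \<theta> p)] (mod n)"
        using w[OF that(5)] that(6) by simp
      ultimately have "a = w p"
        using inj[of a "w p"] that(2) w[OF that(5)] by (meson cong_sym cong_trans)
      with x that show False by simp
    qed
    define plain where "plain z \<longleftrightarrow> \<mu> x z = c \<and> c < 2 * N \<and>
        (c \<in> P \<longrightarrow> {x, z} \<noteq> {y c, w c}) \<and> (\<forall>p\<in>P. c = p + N \<longrightarrow> {x, z} \<noteq> {p, y p})" for z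
    define pair where "pair z \<longleftrightarrow> \<mu> x z = 2 * N \<and> (\<exists>p\<in>P. c = p + N \<and> {x, z} = {p, p + N})" for z
    define swap where "swap z \<longleftrightarrow> c \<in> P \<and> \<mu> x z = c + N \<and> w c \<noteq> c \<and> {x, z} = {c, y c}" for z
    have "plain a \<or> pair a \<or> swap a" "plain b \<or> pair b \<or> swap b"
      using hue[OF x(1,2,4) c(1)] hue[OF x(1,3,5) c(2)]
      unfolding plain_def pair_def swap_def by blast+
    moreover have "\<not> (plain z \<and> pair z')" if "z \<le> 2 * N" "x \<noteq> z" for z z'
    proof
      assume *: "plain z \<and> pair z'"
      then obtain p where p: "p \<in> P" "c = p + N" "{x, z'} = {p, p + N}"
        unfolding pair_def by blast
      moreover have "x \<in> {p, p + N}" using p(3) by blast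
      ultimately show False
        using mixed_pair[of x z p] * x(1) that unfolding plain_def by blast
    qed
    moreover have "\<not> (plain z \<and> swap z')" if "z \<le> 2 * N" "x \<noteq> z" for z z'
    proof
      assume *: "plain z \<and> swap z'"
      then have "x \<in> {c, y c}" unfolding swap_def by blast
      then show False
        using mixed_swap[of x z c] * x(1) that unfolding plain_def swap_def by blast
    qed
    moreover have "\<not> (pair z \<and> swap z')" for z z'
      using P unfolding pair_def swap_def by auto
    ultimately have "plain a \<and> plain b \<or> pair a \<and> pair b \<or> swap a \<and> swap b"
      using x by blast
    then have "\<mu> x a = \<mu> x b"
      unfolding plain_def pair_def swap_def by auto
    then show "a = b"
      using \<mu>_inj x by blast
  qed
  show thesis
  proof (rule that[of \<kappa>])
    show "\<kappa> x a = \<kappa> a x" for x a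
      unfolding \<kappa>_def \<mu>_sym[of x a] insert_commute[of x a "{}"] min.commute[of x a] ..
    show "a = b" if "x \<le> 2 * N" "a \<le> 2 * N" "b \<le> 2 * N" "x \<noteq> a" "x \<noteq> b"
      "\<kappa> x a = Hue c" "\<kappa> x b = Hue c" for x a b c
      using proper that by blast
    show "\<exists>p\<in>P. x = p \<or> x = p + N" if "x \<le> 2 * N" "a \<le> 2 * N" "x \<noteq> a" "\<kappa> x a = Hue x" for x a
      using hue[OF that] \<mu>_self[of a x] that by auto
    show "\<exists>p. p < N \<and> p \<notin> P \<and> {x, a} = {p, p + N}"
      if "x \<le> 2 * N" "a \<le> 2 * N" "x \<noteq> a" "\<kappa> x a = Partner" for x a
    proof -
      have "\<mu> x a = 2 * N" "min x a \<notin> P"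
        using that(4) by (auto simp: \<kappa>_def Let_def split: if_splits)
      then show ?thesis using zero_sum[OF that(1-3)] by blast
    qed
    show "\<exists>p\<in>P. {x, a} = {y p, w p}"
      if "x \<le> 2 * N" "a \<le> 2 * N" "x \<noteq> a" "\<kappa> x a = Spare" for x a
    proof -
      have "(\<exists>p\<in>P. {x, a} = {y p, w p}) \<or> (\<exists>p\<in>P. w p = p \<and> {x, a} = {p, y p})"
        using that(4) by (auto simp: \<kappa>_def Let_def split: if_splits)
      then show ?thesis by (metis insert_commute)
    qed
    show "c < 2 * N" if "x \<le> 2 * N" "a \<le> 2 * N" "x \<noteq> a" "\<kappa> x a = Hue c" for x a c
      using hue[OF that] P by auto
  qed
qed

section \<open>Residues whose dilates by 1, -3 and 5 are distinct up to sign\<close>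

lemma cong_small_imp_abs_eq:
  fixes u v n :: int
  assumes "[u = v] (mod n) \<or> [u = - v] (mod n)" and "2 * \<bar>u\<bar> < n" and "2 * \<bar>v\<bar> < n"
  shows "\<bar>u\<bar> = \<bar>v\<bar>"
proof -
  have "n dvd u - v \<or> n dvd u + v"
    using assms(1) by (auto simp: cong_iff_dvd_diff)
  then have "u - v = 0 \<or> u + v = 0"
    using dvd_imp_le_int[of "u - v" n] dvd_imp_le_int[of "u + v" n] assms(2,3) by linarith
  then show ?thesis by auto
qed

text \<open>
  The multiplier 5 is only needed for labels beyond the first \<open>2 * s\<close>; it has to be left out when
  \<open>n = 5\<close>, where it vanishes.
\<close>

definition multipliers :: "nat \<Rightarrow> nat \<Rightarrow> int set" where
  "multipliers N s = {1, -3} \<union> (if 2 * s < N then {5} else {})"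

text \<open>The dilates are to become labels of up to three blocks of \<open>s\<close> columns.
  Partner columns carry opposite labels, so coincidences have to be excluded up to sign.\<close>

definition distinct_dilates :: "nat \<Rightarrow> nat \<Rightarrow> (nat \<Rightarrow> int) \<Rightarrow> bool" where
  "distinct_dilates N s T \<longleftrightarrow>
    (\<forall>a\<in>multipliers N s. \<forall>b\<in>multipliers N s. \<forall>c<s. \<forall>d<s.
      [a * T c = b * T d] (mod (2 * int N + 1)) \<or> [a * T c = - (b * T d)] (mod (2 * int N + 1))
      \<longrightarrow> a = b \<and> c = d) \<and>
    (\<forall>a\<in>multipliers N s. \<forall>c<s. \<not> [a * T c = 0] (mod (2 * int N + 1)))"

lemma distinct_dilates_exist:
  fixes N s :: nat
  assumes "1 \<le> s" and "2 \<le> N" and big: "s = 1 \<or> (4 * s + 1) * (s - 1) < N"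
  shows "\<exists>T. distinct_dilates N s T"
proof -
  let ?n = "2 * int N + 1"
  have found: ?thesis
    if "\<And>a b c d. \<lbrakk>a \<in> multipliers N s; b \<in> multipliers N s; c < s; d < s;
        [a * T c = b * T d] (mod ?n) \<or> [a * T c = - (b * T d)] (mod ?n)\<rbrakk> \<Longrightarrow> a = b \<and> c = d"
      "\<And>a c. \<lbrakk>a \<in> multipliers N s; c < s\<rbrakk> \<Longrightarrow> \<not> [a * T c = 0] (mod ?n)" for T
    by (rule exI[of _ T], unfold distinct_dilates_def, intro conjI ballI allI impI)
      (use that in blast)+
  \<comment> \<open>If \<open>5 * T c \<le> N\<close>, all dilates have absolute value below
    \<open>n / 2\<close>, so congruence up to sign becomes an equation between positive
    integers.\<close>
  have small: ?thesis
    if T: "\<And>c. c < s \<Longrightarrow> 0 < T c \<and> 5 * T c \<le> int N"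
      and inj: "\<And>a b c d. \<lbrakk>a \<in> {1, 3, 5}; b \<in> {1, 3, 5}; c < s; d < s; a * T c = b * T d\<rbrakk> \<Longrightarrow> a = b \<and> c = d"
    for T
  proof (rule found[of T], goal_cases)
    case (1 a b c d)
    have ab: "\<bar>a\<bar> \<in> {1, 3, 5}" "\<bar>b\<bar> \<in> {1, 3, 5}" "\<bar>a\<bar> = \<bar>b\<bar> \<Longrightarrow> a = b"
      using 1(1,2) by (auto simp: multipliers_def split: if_splits)
    have "\<bar>a * T c\<bar> = \<bar>b * T d\<bar>"
      using T[OF 1(3)] T[OF 1(4)] ab(1,2)
      by (intro cong_small_imp_abs_eq[OF 1(5)]) (auto simp: abs_mult)
    then have "\<bar>a\<bar> * T c = \<bar>b\<bar> * T d"
      using T[OF 1(3)] T[OF 1(4)] by (simp add: abs_mult)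
    then show ?case using inj[OF ab(1,2) 1(3,4)] ab(3) by blast
  next
    case (2 a c)
    have a: "\<bar>a\<bar> \<in> {1, 3, 5}" using 2(1) by (auto simp: multipliers_def split: if_splits)
    then have "a * T c \<noteq> 0" "2 * \<bar>a * T c\<bar> < ?n"
      using T[OF 2(2)] by (auto simp: abs_mult)
    then show ?case
      using cong_small_imp_abs_eq[of "a * T c" 0 ?n] by auto
  qed
  \<comment> \<open>The last condition says \<open>5 * (3 * (s - 1) + 1) \<le> N\<close>, as the
    progression used there requires; from \<open>s = 4\<close> on, the quadratic bound implies it.
    The first case leaves only the moduli 5, 7 and 9.\<close>
  consider "s = 1" "N < 5" | "s = 2 \<or> s = 3" | "15 * s \<le> N + 10"
  proof -
    assume *: "s = 1 \<Longrightarrow> N < 5 \<Longrightarrow> thesis" "s = 2 \<or> s = 3 \<Longrightarrow> thesis" "15 * s \<le> N + 10 \<Longrightarrow> thesis"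
    consider "s = 1" "N < 5" | "s = 1" "5 \<le> N" | "s = 2 \<or> s = 3" | "4 \<le> s"
      using assms(1) by linarith
    then show thesis
    proof cases
      case 4
      then obtain t where t: "s = t + 4" using le_Suc_ex by (metis add.commute)
      then have "(4 * t + 17) * (t + 3) < N" using big by (simp add: algebra_simps)
      moreover have "(4 * t + 17) * (t + 3) = 4 * (t * t) + 29 * t + 51" by (simp add: algebra_simps)
      ultimately have "15 * s \<le> N + 10" using t by linarith
      then show thesis by (rule *)
    qed (use * in auto)
  qed
  then show ?thesis
  proof cases
    case 1
    then have N: "N = 2 \<or> N = 3 \<or> N = 4" using assms(2) by linarith
    then have *: "a = b" if "a \<in> multipliers N s" "b \<in> multipliers N s"
        "[a = b] (mod ?n) \<or> [a = - b] (mod ?n)" for a b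
      by (elim disjE) (use that 1(1) in \<open>auto simp: multipliers_def cong_def\<close>)
    from N have "\<not> [a = 0] (mod ?n)" if "a \<in> multipliers N s" for a
      by (elim disjE) (use that 1(1) in \<open>auto simp: multipliers_def cong_def\<close>)
    then show ?thesis
      using * 1(1) by (intro found[of "\<lambda>_. 1"]) auto
  next
    case 2
    \<comment> \<open>Powers of 2 work because the multipliers are odd up to sign and at most 5: the
      factorisation into a power of 2 and an odd number is unique.\<close>
    define T :: "nat \<Rightarrow> int" where "T c = (if c = 0 then 1 else if c = 1 then 2 else 4)" for c
    have T: "c = 0 \<and> T c = 1 \<or> c = 1 \<and> T c = 2 \<or> c = 2 \<and> s = 3 \<and> T c = 4" if "c < s" for c
      using that 2 by (auto simp: T_def)
    show ?thesis
    proof (rule small[of T])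
      show "0 < T c \<and> 5 * T c \<le> int N" if "c < s" for c
        using T[OF that] 2 big by auto
      show "a = b \<and> c = d"
        if "a \<in> {1, 3, 5}" "b \<in> {1, 3, 5}" "c < s" "d < s" "a * T c = b * T d" for a b c d
      proof -
        have "T c \<in> {1, 2, 4}" "T d \<in> {1, 2, 4}" by (simp_all add: T_def)
        with that(1,2,5) have ab: "a = b \<and> T c = T d" by auto
        moreover have "c < 3" "d < 3" using that(3,4) 2 by auto
        ultimately have "c = d" by (auto simp: T_def split: if_splits)
        with ab show ?thesis by simp
      qed
    qed
  next
    case 3
    \<comment> \<open>Modulo 3 the numbers \<open>3 * c + 1\<close> are 1, so their products with 1,
      3 and 5 lie in the three different classes 1, 0 and 2.\<close>
    show ?thesis
    proof (rule small[of "\<lambda>c. 3 * int c + 1"])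
      fix a b :: int and c d
      assume ab: "a \<in> {1, 3, 5}" "b \<in> {1, 3, 5}" and eq: "a * (3 * int c + 1) = b * (3 * int d + 1)"
      have "a = 1 \<or> a = 3 \<or> a = 5" "b = 1 \<or> b = 3 \<or> b = 5" using ab by auto
      then show "a = b \<and> c = d" using eq by (elim disjE; hypsubst; presburger)
    qed (use 3 in auto)
  qed
qed

text \<open>What the board needs from row \<open>i\<close>. Pairs are attached to rows in
  consecutive blocks of \<open>s\<close>: \<open>x mod N\<close> names the pair of column
  \<open>x\<close>, and its quotient by \<open>s\<close> the row. The spare edges belong to one
  matching common to all rows, so a single bishop colour can take them.\<close>

definition line_colouring :: "nat \<Rightarrow> nat \<Rightarrow> nat \<Rightarrow> (nat \<Rightarrow> nat \<Rightarrow> line_colour) \<Rightarrow> bool" where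
  "line_colouring N s i \<kappa> \<longleftrightarrow> (\<forall>x y. \<kappa> x y = \<kappa> y x) \<and>
    (\<forall>x\<le>2 * N. \<forall>a\<le>2 * N. x \<noteq> a \<longrightarrow>
      (\<forall>b\<le>2 * N. \<forall>c. x \<noteq> b \<longrightarrow> \<kappa> x a = Hue c \<longrightarrow> \<kappa> x b = Hue c \<longrightarrow> a = b) \<and>
      (\<kappa> x a = Hue x \<longrightarrow> x mod N div s = i) \<and>
      (\<kappa> x a = Partner \<longrightarrow> (\<exists>p<N. p div s \<noteq> i \<and> {x, a} = {p, p + N})) \<and>
      (\<kappa> x a = Spare \<longrightarrow> (\<exists>c<s. {x, a} = {c, c + s})) \<and>
      (\<forall>c. \<kappa> x a = Hue c \<longrightarrow> c < 2 * N))"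

lemma line_colouringD:
  assumes "line_colouring N s i \<kappa>" and "x \<le> 2 * N" and "a \<le> 2 * N" and "x \<noteq> a"
  shows line_colouring_proper: "\<lbrakk>\<kappa> x a = Hue c; \<kappa> x b = Hue c; b \<le> 2 * N; x \<noteq> b\<rbrakk> \<Longrightarrow> a = b"
    and line_colouring_self: "\<kappa> x a = Hue x \<Longrightarrow> x mod N div s = i"
    and line_colouring_Partner: "\<kappa> x a = Partner \<Longrightarrow> \<exists>p<N. p div s \<noteq> i \<and> {x, a} = {p, p + N}"
    and line_colouring_Spare: "\<kappa> x a = Spare \<Longrightarrow> \<exists>c<s. {x, a} = {c, c + s}"
    and line_colouring_Hue: "\<kappa> x a = Hue c \<Longrightarrow> c < 2 * N"
proof -
  note * = assms(1)[unfolded line_colouring_def, THEN conjunct2, THEN spec, THEN mp, OF assms(2),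
      THEN spec, THEN mp, OF assms(3), THEN mp, OF assms(4)]
  show "\<lbrakk>\<kappa> x a = Hue c; \<kappa> x b = Hue c; b \<le> 2 * N; x \<noteq> b\<rbrakk> \<Longrightarrow> a = b"
    using *[THEN conjunct1] by blast
  note * = *[THEN conjunct2]
  show "\<kappa> x a = Hue x \<Longrightarrow> x mod N div s = i"
    using *[THEN conjunct1] by blast
  note * = *[THEN conjunct2]
  show "\<kappa> x a = Partner \<Longrightarrow> \<exists>p<N. p div s \<noteq> i \<and> {x, a} = {p, p + N}"
    using *[THEN conjunct1] by (rule mp)
  note * = *[THEN conjunct2]
  show "\<kappa> x a = Spare \<Longrightarrow> \<exists>c<s. {x, a} = {c, c + s}"
    using *[THEN conjunct1] by (rule mp)
  show "\<kappa> x a = Hue c \<Longrightarrow> c < 2 * N"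
    using *[THEN conjunct2] by blast
qed

text \<open>
  The labels attached to row \<open>i\<close> are \<open>i * s + c\<close> with \<open>c < s\<close>, and the spare edges of the row join
  columns \<open>c\<close> and \<open>c + s\<close>. In rows 0 and 1 one of these two columns itself carries the label
  \<open>i * s + c\<close>, so there the spare edge must be \<open>{p, - 3 p}\<close>; in all other rows it is \<open>{- 3 p, 5 p}\<close>.
\<close>

lemma line_colouring_exists:
  fixes N s i :: nat
  assumes s: "1 \<le> s" "2 * s \<le> N"
    and T: "distinct_dilates N s T"
  shows "\<exists>\<kappa>. line_colouring N s i \<kappa>"
proof -
  let ?n = "2 * int N + 1"
  have distinct: "a = b \<and> c = d"
    if "a \<in> multipliers N s" "b \<in> multipliers N s" "c < s" "d < s"
      "[a * T c = b * T d] (mod ?n) \<or> [a * T c = - (b * T d)] (mod ?n)" for a b c d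
    using T that unfolding distinct_dilates_def by blast
  have nonzero: "\<not> [a * T c = 0] (mod ?n)" if "a \<in> multipliers N s" "c < s" for a c
    using T that unfolding distinct_dilates_def by blast
  define P where "P = {p. p < N \<and> p div s = i}"
  define A where "A = (if P = {} then {} else {x. x < N \<and> x div s \<in> {0, 1, i}})"
  \<comment> \<open>Within \<open>A\<close>, block \<open>i\<close> gets multiplier 1, the first
    other block gets -3, and a remaining one gets 5.\<close>
  define \<beta> :: "nat \<Rightarrow> int" where
    "\<beta> k = (if k = i then 1 else if k = 0 \<or> k = 1 \<and> i = 0 then - 3 else 5)" for k
  define g where "g x = \<beta> (x div s) * T (x mod s)" for x
  define y where "y p = p mod s + (if i = 0 then s else 0)" for p
  define w where "w p = (if i < 2 then p else p mod s + s)" for p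
  have \<beta>: "\<beta> (x div s) \<in> multipliers N s" if x: "x \<in> A" for x
  proof -
    \<comment> \<open>Only these rows use the multiplier 5; their block starts at
      \<open>i * s\<close>, beyond blocks 0 and 1, and contains a column below
      \<open>N\<close>.\<close>
    have "2 * s < N" if i: "2 \<le> i"
    proof -
      obtain p where p: "p < N" "p div s = i" using x by (auto simp: A_def P_def split: if_splits)
      have "2 * s \<le> i * s" using i by simp
      also have "i * s \<le> p" using p(2) by (metis div_times_less_eq_dividend)
      finally show ?thesis using p(1) by simp
    qed
    then show ?thesis using x by (auto simp: \<beta>_def multipliers_def A_def split: if_splits)
  qed
  have mod_s: "x mod s < s" for x using s by simp
  have "A \<subseteq> {..<N}" by (auto simp: A_def)
  moreover have "\<not> [g x = 0] (mod ?n)" if "x \<in> A" for x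
    unfolding g_def using nonzero[OF \<beta>[OF that] mod_s] .
  moreover have "x = z" if "x \<in> A" "z \<in> A" "[g x = g z] (mod ?n) \<or> [g x = - g z] (mod ?n)" for x z
  proof -
    have *: "\<beta> (x div s) = \<beta> (z div s)" "x mod s = z mod s"
      using distinct[OF \<beta>[OF that(1)] \<beta>[OF that(2)] mod_s mod_s] that(3) unfolding g_def by blast+
    have "x div s = z div s"
      using *(1) that(1,2) by (auto simp: \<beta>_def A_def split: if_splits)
    then show ?thesis using *(2) by (metis div_mult_mod_eq)
  qed
  ultimately obtain \<theta> where \<theta>: "\<And>x. x \<in> A \<Longrightarrow> \<theta> x = g x" "\<And>x. x < N \<Longrightarrow> \<theta> (x + N) = - \<theta> x" "\<theta> (2 * N) = (0 :: int)"
    "\<And>x z. x \<le> 2 * N \<Longrightarrow> z \<le> 2 * N \<Longrightarrow> [\<theta> x = \<theta> z] (mod ?n) \<Longrightarrow> x = z"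
    using signed_labelling_extends[of A N g] by blast
  have pi: "\<beta> (p div s) = 1" if "p \<in> P" for p
    using that by (simp add: P_def \<beta>_def)
  have PA: "p \<in> A" if "p \<in> P" for p
    using that by (auto simp: A_def P_def)
  have low: "x \<in> A" if "x < 2 * s" "p \<in> P" for x p
  proof -
    have "x div s < 2" using that(1) s by (simp add: less_mult_imp_div_less)
    then show ?thesis using that s(2) by (auto simp: A_def)
  qed
  have div_low: "(p mod s) div s = 0" "(p mod s + s) div s = 1" "(p mod s + s) mod s = p mod s" for p
    using s mod_s[of p] by (simp_all add: div_add_self2)
  have y: "y p \<le> 2 * N \<and> [\<theta> (y p) = - 3 * \<theta> p] (mod ?n)" if p: "p \<in> P" for p
  proof -
    have lt: "y p < 2 * s" using mod_s[of p] by (auto simp: y_def)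
    have "g (y p) = - 3 * g p"
    proof -
      have "y p mod s = p mod s" "\<beta> (y p div s) = - 3"
        by (cases "i = 0"; simp add: y_def div_low \<beta>_def)+
      then show ?thesis by (simp add: g_def pi[OF p])
    qed
    then show ?thesis
      using lt s(2) \<theta>(1)[OF low[OF lt p]] \<theta>(1)[OF PA[OF p]] by simp
  qed
  have w: "w p \<le> 2 * N \<and> (w p = p \<or> [\<theta> (w p) = 5 * \<theta> p] (mod ?n))" if p: "p \<in> P" for p
  proof (cases "i < 2")
    case True
    then show ?thesis using p by (simp add: w_def P_def)
  next
    case False
    then have lt: "w p < 2 * s" using mod_s[of p] by (auto simp: w_def)
    have "g (w p) = 5 * g p"
    proof -
      have "w p mod s = p mod s" "\<beta> (w p div s) = 5"
        using False by (simp_all add: w_def div_low \<beta>_def)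
      then show ?thesis by (simp add: g_def pi[OF p])
    qed
    then show ?thesis
      using lt s(2) \<theta>(1)[OF low[OF lt p]] \<theta>(1)[OF PA[OF p]] by simp
  qed
  have yw: "{y p, w p} = {p mod s, p mod s + s}" if "p \<in> P" for p
  proof -
    have p: "p = i * s + p mod s" using that by (simp add: P_def) (metis div_mult_mod_eq)
    consider "i = 0" | "i = 1" | "2 \<le> i" by linarith
    then show ?thesis
      using p by cases (auto simp: y_def w_def)
  qed
  have "P \<subseteq> {..<N}" by (auto simp: P_def)
  from line_colouring_from_labelling[OF \<theta>(2,3,4) this y w]
  obtain \<kappa> where \<kappa>: "\<And>x y. \<kappa> x y = \<kappa> y x"
    "\<And>x a b c. \<lbrakk>x \<le> 2 * N; a \<le> 2 * N; b \<le> 2 * N; x \<noteq> a; x \<noteq> b; \<kappa> x a = Hue c; \<kappa> x b = Hue c\<rbrakk> \<Longrightarrow> a = b"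
    "\<And>x a. \<lbrakk>x \<le> 2 * N; a \<le> 2 * N; x \<noteq> a; \<kappa> x a = Hue x\<rbrakk> \<Longrightarrow> \<exists>p\<in>P. x = p \<or> x = p + N"
    "\<And>x a. \<lbrakk>x \<le> 2 * N; a \<le> 2 * N; x \<noteq> a; \<kappa> x a = Partner\<rbrakk> \<Longrightarrow> \<exists>p. p < N \<and> p \<notin> P \<and> {x, a} = {p, p + N}"
    "\<And>x a. \<lbrakk>x \<le> 2 * N; a \<le> 2 * N; x \<noteq> a; \<kappa> x a = Spare\<rbrakk> \<Longrightarrow> \<exists>p\<in>P. {x, a} = {y p, w p}"
    "\<And>x a c. \<lbrakk>x \<le> 2 * N; a \<le> 2 * N; x \<noteq> a; \<kappa> x a = Hue c\<rbrakk> \<Longrightarrow> c < 2 * N"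
    by blast
  have "line_colouring N s i \<kappa>"
    unfolding line_colouring_def
  proof (intro conjI allI impI, goal_cases)
    case (1 x y)
    show ?case by (rule \<kappa>(1))
  next
    case (2 x a b c)
    then show ?case using \<kappa>(2)[of x a b c] by blast
  next
    case (3 x a)
    then show ?case using \<kappa>(3)[of x a] by (auto simp: P_def)
  next
    case (4 x a)
    then show ?case using \<kappa>(4)[of x a] unfolding P_def by blast
  next
    case (5 x a)
    then obtain p where "p \<in> P" "{x, a} = {y p, w p}" using \<kappa>(5)[of x a] by blast
    then have "{x, a} = {p mod s, p mod s + s}" using yw by simp
    then show ?case using mod_s by blast
  next
    case (6 x a c)
    then show ?case using \<kappa>(6)[of x a c] by blast
  qed
  then show ?thesis by (rule exI[of _ \<kappa>])
qed

section \<open>Bishop moves\<close>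

text \<open>
  The colours \<open>B d up b\<close> belong to cyclic row step \<open>d\<close> and walks to the right (\<open>up\<close>) or to the left;
  \<open>b\<close> alternates along each path and is true for its first edge.
\<close>

datatype queen_colour = H nat | V int | B int bool bool

text \<open>Recurses to the preceding cell of the path, whose column differs by the plain row
  distance \<open>e\<close>, not the cyclic one. For a row of the board, \<open>e = 0\<close> only
  if \<open>m\<close> divides \<open>d\<close>; this guard and leaving the board end the
  recursion.\<close>

function alternate :: "int \<Rightarrow> int \<Rightarrow> int \<Rightarrow> bool \<Rightarrow> int \<Rightarrow> int \<Rightarrow> bool" where
  "alternate m n d up i j =
    (let i' = (i - d) mod m; e = \<bar>i - i'\<bar>; j' = (if up then j - e else j + e) in
     if e = 0 \<or> j' < 0 \<or> n \<le> j' then True else \<not> alternate m n d up i' j')"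
  by pat_completeness auto
termination
  by (relation "measure (\<lambda>(m, n, d, up, i, j). nat (if up then j else n - j))") auto

declare alternate.simps [simp del]

definition shift :: "nat \<Rightarrow> nat \<times> nat \<Rightarrow> nat \<times> nat \<Rightarrow> int" where
  "shift m u v = (int (fst v) - int (fst u)) mod int m"

definition step_colour :: "nat \<Rightarrow> nat \<Rightarrow> nat \<times> nat \<Rightarrow> nat \<times> nat \<Rightarrow> queen_colour" where
  "step_colour m n u v = B (shift m u v) (snd u < snd v)
     (alternate (int m) (int n) (shift m u v) (snd u < snd v) (int (fst u)) (int (snd u)))"

text \<open>Orients the edge by its smaller cyclic step: for odd \<open>m\<close> and distinct rows
  exactly one direction has a step below \<open>m / 2\<close>.\<close>

definition diag_colour :: "nat \<Rightarrow> nat \<Rightarrow> nat \<times> nat \<Rightarrow> nat \<times> nat \<Rightarrow> queen_colour" where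
  "diag_colour m n u v = (if 2 * shift m u v < int m then step_colour m n u v else step_colour m n v u)"

definition diagonal :: "nat \<times> nat \<Rightarrow> nat \<times> nat \<Rightarrow> bool" where
  "diagonal u v \<longleftrightarrow> fst u \<noteq> fst v \<and>
     \<bar>int (fst u) - int (fst v)\<bar> = \<bar>int (snd u) - int (snd v)\<bar>"

lemma diagonal_sym: "diagonal u v \<Longrightarrow> diagonal v u"
  by (auto simp: diagonal_def)

lemma queen_adj_cases:
  assumes "queen_adj u v"
  obtains (row) "fst u = fst v" "snd u \<noteq> snd v" | (column) "fst u \<noteq> fst v" "snd u = snd v"
    | (diagonal) "diagonal u v" "fst u \<noteq> fst v" "snd u \<noteq> snd v"
  using assms unfolding queen_adj_def diagonal_def by (cases u; cases v; auto)

lemma shift_cases: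
  assumes "fst u < m" "fst v < m" "fst u \<noteq> fst v"
  shows "shift m u v = int (fst v) - int (fst u) \<and> fst u < fst v \<or>
    shift m u v = int (fst v) - int (fst u) + int m \<and> fst v < fst u"
proof (cases "fst u < fst v")
  case True
  then show ?thesis using assms by (simp add: shift_def mod_pos_pos_trivial)
next
  case False
  have "shift m u v = (int (fst v) - int (fst u) + int m) mod int m"
    by (simp add: shift_def)
  also have "\<dots> = int (fst v) - int (fst u) + int m"
    using False assms by (intro mod_pos_pos_trivial) auto
  finally show ?thesis using False assms by simp
qed

lemma shift_flip:
  assumes "fst u < m" "fst v < m" "fst u \<noteq> fst v" "odd m"
  shows "2 * shift m v u < int m \<longleftrightarrow> \<not> 2 * shift m u v < int m"
proof -
  have "shift m u v + shift m v u = int m"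
    using shift_cases[OF assms(1-3)] shift_cases[of v m u] assms by linarith
  moreover have "2 * shift m u v \<noteq> int m"
    using assms(4) by presburger
  ultimately show ?thesis by linarith
qed

lemma diag_colour_sym:
  assumes "fst u < m" "fst v < m" "fst u \<noteq> fst v" "odd m"
  shows "diag_colour m n u v = diag_colour m n v u"
  using shift_flip[OF assms] by (simp add: diag_colour_def)

text \<open>The cell before \<open>v\<close> on its path is \<open>u\<close>, so one unfolding of
  the recursion suffices.\<close>

lemma alternate_step:
  assumes "fst u < m" "fst v < m" "snd u < n" "diagonal u v"
  shows "alternate (int m) (int n) (shift m u v) (snd u < snd v) (int (fst v)) (int (snd v)) \<longleftrightarrow>
    \<not> alternate (int m) (int n) (shift m u v) (snd u < snd v) (int (fst u)) (int (snd u))"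
proof -
  have i: "(int (fst v) - shift m u v) mod int m = int (fst u)"
    using assms(1) by (simp add: shift_def mod_diff_right_eq)
  have j: "(if snd u < snd v then int (snd v) - \<bar>int (fst v) - int (fst u)\<bar>
      else int (snd v) + \<bar>int (fst v) - int (fst u)\<bar>) = int (snd u)"
    using assms(4) by (auto simp: diagonal_def)
  show ?thesis
    by (subst alternate.simps) (use assms in \<open>simp add: Let_def i j diagonal_def\<close>)
qed

lemma diagonal_determined:
  assumes "fst u < m" "fst v < m" "fst w < m" "diagonal u v" "diagonal u w"
    and "shift m u v = shift m u w \<or> shift m v u = shift m w u"
    and "snd u < snd v \<longleftrightarrow> snd u < snd w"
  shows "v = w"
proof -
  have "fst v = fst w"
    using assms(6)
  proof
    assume "shift m u v = shift m u w"
    then show ?thesis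
      using shift_cases[OF assms(1,2)] shift_cases[OF assms(1,3)] assms(2-5)
      unfolding diagonal_def by auto
  next
    assume "shift m v u = shift m w u"
    then show ?thesis
      using shift_cases[OF assms(2,1)] shift_cases[OF assms(3,1)] assms(2-5)
      unfolding diagonal_def by auto
  qed
  moreover have "snd v = snd w"
    using calculation assms(4,5,7) unfolding diagonal_def by (auto simp: abs_if split: if_splits)
  ultimately show ?thesis by (rule prod_eqI)
qed

text \<open>For each step and direction a cell has at most one outgoing and one incoming edge. These
  two are consecutive on a path and differ in the alternating bit, so equal colours mean two
  outgoing or two incoming edges, which coincide.\<close>

lemma diag_colour_proper:
  assumes "odd m" and cells: "u \<in> queen_cells m n" "v \<in> queen_cells m n" "w \<in> queen_cells m n"
    and diag: "diagonal u v" "diagonal u w" and eq: "diag_colour m n u v = diag_colour m n u w"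
  shows "v = w"
proof -
  have range: "fst u < m" "fst v < m" "fst w < m" "snd u < n" "snd v < n" "snd w < n"
    using cells by (auto simp: queen_cells_def)
  have mixed: "step_colour m n u z \<noteq> step_colour m n z' u"
    if "z' \<in> queen_cells m n" "diagonal u z'" for z z'
  proof
    assume eq: "step_colour m n u z = step_colour m n z' u"
    have "shift m u z = shift m z' u" "(snd u < snd z) = (snd z' < snd u)"
      using eq unfolding step_colour_def by blast+
    then have "alternate (int m) (int n) (shift m z' u) (snd z' < snd u) (int (fst u)) (int (snd u)) =
        alternate (int m) (int n) (shift m z' u) (snd z' < snd u) (int (fst z')) (int (snd z'))"
      using eq unfolding step_colour_def by simp
    moreover have "fst z' < m" "snd z' < n"
      using that(1) by (auto simp: queen_cells_def)
    ultimately show False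
      using alternate_step[of z' m u n] range(1) diagonal_sym[OF that(2)] by blast
  qed
  have ne: "snd u \<noteq> snd v" "snd u \<noteq> snd w"
    using diag by (auto simp: diagonal_def)
  have "step_colour m n u v \<noteq> step_colour m n w u" "step_colour m n u w \<noteq> step_colour m n v u"
    using mixed cells diag by blast+
  then have "step_colour m n u v = step_colour m n u w \<or> step_colour m n v u = step_colour m n w u"
    using eq unfolding diag_colour_def by (simp split: if_splits)
  then consider (tail) "step_colour m n u v = step_colour m n u w"
    | (head) "step_colour m n v u = step_colour m n w u" by blast
  then show ?thesis
  proof cases
    case tail
    then have "shift m u v = shift m u w" "(snd u < snd v) = (snd u < snd w)"
      unfolding step_colour_def by blast+
    then show ?thesis using diagonal_determined[OF range(1-3) diag] by blast
  next
    case head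
    then have "shift m v u = shift m w u" "(snd v < snd u) = (snd w < snd u)"
      unfolding step_colour_def by blast+
    moreover from this(2) have "(snd u < snd v) = (snd u < snd w)" using ne by linarith
    ultimately show ?thesis using diagonal_determined[OF range(1-3) diag] by blast
  qed
qed

lemma diag_colour_range:
  assumes "odd m" "fst u < m" "fst v < m" "fst u \<noteq> fst v"
  obtains d up b where "diag_colour m n u v = B d up b" "1 \<le> d" "2 * d < int m"
proof -
  have "1 \<le> shift m u v" "1 \<le> shift m v u"
    using shift_cases[of u m v] shift_cases[of v m u] assms by linarith+
  then show thesis
    using that shift_flip[of u m v] assms by (auto simp: diag_colour_def step_colour_def split: if_splits)
qed

text \<open>A cyclic step of \<open>D\<close> changes the row by \<open>D\<close> or
  \<open>D + 1\<close>, so a rightward path arrives only in column \<open>D\<close> or beyond. Cells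
  further left can only start such a path, with bit \<open>True\<close>; the other colour stays free
  for spare edges.\<close>

lemma diag_colour_left:
  assumes "m = 2 * D + 1" "u \<in> queen_cells m n" "v \<in> queen_cells m n" "diagonal u v" "snd u < D"
  shows "diag_colour m n u v \<noteq> B (int D) True False"
proof
  assume c: "diag_colour m n u v = B (int D) True False"
  have range: "fst u < m" "fst v < m"
    using assms by (auto simp: queen_cells_def)
  have far: "int D \<le> \<bar>int (fst u) - int (fst v)\<bar>" if "shift m u v = int D \<or> shift m v u = int D"
    using that shift_cases[of u m v] shift_cases[of v m u] range assms(1,4)
    unfolding diagonal_def by linarith
  from c consider "step_colour m n u v = B (int D) True False" | "step_colour m n v u = B (int D) True False"
    unfolding diag_colour_def by (auto split: if_splits)
  then show False
  proof cases
    case 1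
    then have d: "shift m u v = int D" and
      b: "\<not> alternate (int m) (int n) (int D) True (int (fst u)) (int (snd u))"
      by (auto simp: step_colour_def)
    let ?e = "\<bar>int (fst u) - (int (fst u) - int D) mod int m\<bar>"
    have "?e \<noteq> 0 \<longrightarrow> int D \<le> ?e"
    proof -
      have m: "0 < int m" using assms(1) by simp
      obtain p where p: "(int (fst u) - int D) mod int m = int p"
        using pos_mod_sign[OF m] by (metis nonneg_int_cases)
      then have "p < m" using pos_mod_bound[OF m, of "int (fst u) - int D"] by simp
      \<comment> \<open>\<open>shift\<close> reads rows only; column 0 is a dummy.\<close>
      have "shift m (p, 0) u = (int (fst u) - (int (fst u) - int D)) mod int m"
        unfolding shift_def fst_conv p[symmetric] by (rule mod_diff_right_eq)
      then have "shift m (p, 0) u = int D" using assms(1) by simp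
      then have "p \<noteq> fst u \<longrightarrow> int D \<le> \<bar>int (fst u) - int p\<bar>"
        using shift_cases[of "(p, 0)" m u] \<open>p < m\<close> range(1) assms(1)
        unfolding fst_conv by linarith
      then show ?thesis unfolding p by auto
    qed
    then have "?e = 0 \<or> int (snd u) - ?e < 0" using assms(5) by linarith
    then show False using b by (subst (asm) alternate.simps) (auto simp: Let_def split: if_splits)
  next
    case 2
    then have "shift m v u = int D" "snd v < snd u" by (auto simp: step_colour_def)
    then show False using far assms(4,5) unfolding diagonal_def by linarith
  qed
qed

text \<open>A leftward path would have to enter the last column from outside the board, so it can
  only start there, with bit \<open>True\<close>. The free colour serves vertical edges of that
  column.\<close>

lemma diag_colour_right:
  assumes "u \<in> queen_cells m n" "v \<in> queen_cells m n" "diagonal u v" "Suc (snd u) = n"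
  shows "diag_colour m n u v \<noteq> B d False False"
proof
  assume "diag_colour m n u v = B d False False"
  then consider "step_colour m n u v = B d False False" | "step_colour m n v u = B d False False"
    unfolding diag_colour_def by (auto split: if_splits)
  then show False
  proof cases
    case 1
    then have "\<not> alternate (int m) (int n) d False (int (fst u)) (int (snd u))"
      by (auto simp: step_colour_def)
    then show False
      using assms(4) by (subst (asm) alternate.simps) (auto simp: Let_def split: if_splits)
  next
    case 2
    then have "snd u \<le> snd v" by (auto simp: step_colour_def)
    moreover have "snd v \<noteq> snd u" "snd v < n"
      using assms by (auto simp: diagonal_def queen_cells_def)
    ultimately show False using assms(4) by simp
  qed
qed

section \<open>The whole board\<close>

lemma int_eq_if_dvd_diff:
  assumes "int m dvd int a - int b" "a < m" "b < m"
  shows "a = b"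
proof -
  have "[a = b] (mod m)"
    using assms(1) by (simp add: cong_int_iff[symmetric] cong_iff_dvd_diff)
  then show ?thesis using assms(2,3) by (simp add: cong_def)
qed

lemma queen_colouring:
  fixes m n D N s :: nat and K :: "nat \<Rightarrow> nat \<Rightarrow> nat \<Rightarrow> line_colour"
  assumes m: "m = 2 * D + 1" and n: "n = 2 * N + 1" and "1 \<le> s" "2 * s \<le> D" "N \<le> m * s"
    and K: "\<And>i. line_colouring N s i (K i)"
  obtains c where "proper_edge_colouring (queen_edges m n) c"
    "c ` queen_edges m n \<subseteq> {..<3 * m + n - 4}"
proof -
  define rw where "rw x = (if x < 2 * N then x mod N div s else 0)" for x
  \<comment> \<open>In a column attached to row \<open>r\<close>, vertical edges are coloured
    \<open>i + k - 2 r\<close> with \<open>k \<noteq> i\<close>, so the cell in row \<open>i\<close>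
    misses colour \<open>2 i - 2 r\<close>. Paired columns share \<open>r\<close>, so this colour is
    free at both ends of the edge.\<close>
  define partner_colour where "partner_colour i r = V ((2 * int i - 2 * int r) mod int m)" for i r
  define row where "row i x a = (case K i x a of Hue q \<Rightarrow> H q | Partner \<Rightarrow> partner_colour i (rw x)
      | Spare \<Rightarrow> B (int D) True False)" for i x a
  define column_sum where "column_sum j i k = (int i + int k - 2 * int (rw j)) mod int m" for j i k
  \<comment> \<open>Colour 0 of a paired column becomes its own hue: row edges at that column use it
    only in the attached row, which lies on no vertical edge of sum 0. The hue of the last column is
    outside the palette, so a free leftward bishop colour replaces it.\<close>
  define column where "column j i k = (if column_sum j i k = 0
      then (if j < 2 * N then H j else B (int D) False False) else V (column_sum j i k))" for j i k
  define f where "f u v = (if fst u = fst v then row (fst u) (snd u) (snd v)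
      else if snd u = snd v then column (snd u) (fst u) (fst v) else diag_colour m n u v)" for u v
  define C where "C = H ` {..<n - 1} \<union> V ` {1..<int m} \<union>
    (\<lambda>(d, up, b). B d up b) ` ({1..int D} \<times> UNIV \<times> UNIV)"
  have "odd m" "0 < m" using m by simp_all
  have "1 \<le> D" using assms(3,4) by linarith
  have rw: "rw x < m" for x
  proof (cases "x < 2 * N")
    case True
    then have "x mod N < N" by simp
    then have "x mod N < m * s" using assms(5) by (rule less_le_trans)
    then show ?thesis using True by (simp add: rw_def less_mult_imp_div_less)
  qed (use \<open>0 < m\<close> in \<open>simp add: rw_def\<close>)
  have nonzero: "(2 * int i - 2 * int r) mod int m \<noteq> 0" if "i < m" "r < m" "i \<noteq> r" for i r
  proof
    assume "(2 * int i - 2 * int r) mod int m = 0"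
    then have "int m dvd 2 * (int i - int r)" by (simp add: mod_0_imp_dvd algebra_simps)
    moreover have "coprime (int m) 2" using \<open>odd m\<close> by simp
    ultimately have "int m dvd int i - int r" by (simp only: coprime_dvd_mult_right_iff)
    then show False using int_eq_if_dvd_diff that by blast
  qed
  have K_sym: "K i x a = K i a x" for i x a
    using K unfolding line_colouring_def by blast
  have le: "x \<le> 2 * N" if "x < n" for x
    using that n by simp
  note K_D = line_colouringD[OF K le le]
  have K_hue: "a = b" if "x < n" "a < n" "b < n" "x \<noteq> a" "x \<noteq> b" "K i x a = Hue c" "K i x b = Hue c" for i x a b c
    using K_D(1)[OF that(1,2,4,6,7) le[OF that(3)] that(5)] .
  have K_self: "rw x = i \<and> x < 2 * N" if "x < n" "a < n" "x \<noteq> a" "K i x a = Hue x" for i x a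
    using K_D(2,5)[OF that] by (simp add: rw_def)
  note K_partner = K_D(3) and K_spare = K_D(4) and K_range = K_D(5)
  have partner: "rw x = rw a \<and> rw x \<noteq> i \<and> a = (if x < N then x + N else x - N)"
    if x: "x < n" "a < n" "x \<noteq> a" "K i x a = Partner" for i x a
  proof -
    obtain p where p: "p < N" "p div s \<noteq> i" "{x, a} = {p, p + N}"
      using K_partner[OF x] by blast
    then have "rw p = p div s" "rw (p + N) = p div s" by (simp_all add: rw_def)
    with p show ?thesis by (auto simp: doubleton_eq_iff)
  qed
  have spare: "x < D \<and> a = (if x < s then x + s else x - s)"
    if x: "x < n" "a < n" "x \<noteq> a" "K i x a = Spare" for i x a
  proof -
    obtain c where c: "c < s" "{x, a} = {c, c + s}"
      using K_spare[OF x] by blast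
    with assms(4) show ?thesis by (auto simp: doubleton_eq_iff)
  qed
  have row_sym: "row i x a = row i a x" if "x < n" "a < n" "x \<noteq> a" for i x a
  proof (cases "K i x a")
    case Partner
    then show ?thesis using partner[OF that Partner] K_sym[of i a x] by (simp only: row_def)
  qed (simp_all add: row_def K_sym[of i a x])
  have column_sym: "column j i k = column j k i" for j i k
    by (simp add: column_def column_sum_def add.commute)
  have row_proper: "a = b" if x: "x < n" "a < n" "b < n" "x \<noteq> a" "x \<noteq> b" and eq: "row i x a = row i x b" for i x a b
  proof (cases "K i x a")
    case (Hue q)
    then have "K i x b = Hue q"
      using eq by (simp add: row_def partner_colour_def split: line_colour.splits)
    then show ?thesis using K_hue[OF x Hue] by blast
  next
    case Partner
    then have "K i x b = Partner"
      using eq by (simp add: row_def partner_colour_def split: line_colour.splits)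
    then show ?thesis using partner[OF x(1,2,4) Partner] partner[OF x(1,3,5)] by metis
  next
    case Spare
    then have "K i x b = Spare"
      using eq by (simp add: row_def partner_colour_def split: line_colour.splits)
    then show ?thesis using spare[OF x(1,2,4) Spare] spare[OF x(1,3,5)] by metis
  qed
  have column_proper: "k = l" if "k < m" "l < m" "column j i k = column j i l" for i j k l
  proof -
    have "column_sum j i k = column_sum j i l"
      using that(3) unfolding column_def by (simp split: if_splits)
    then have "int m dvd int k - int l"
      unfolding column_sum_def mod_eq_dvd_iff by (simp add: algebra_simps)
    then show ?thesis using int_eq_if_dvd_diff that by blast
  qed
  have row_column: "row i x a \<noteq> column x i k"
    if x: "x < n" "a < n" "x \<noteq> a" and k: "i < m" "k < m" "i \<noteq> k" for i x a k
  proof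
    assume eq: "row i x a = column x i k"
    show False
    proof (cases "K i x a")
      case (Hue q)
      then have "column_sum x i k = 0" "q = x"
        using eq by (auto simp: row_def column_def split: if_splits)
      then have "rw x = i" using K_self[OF x] Hue by blast
      then have "int m dvd int k - int i"
        using \<open>column_sum x i k = 0\<close> by (simp add: column_sum_def mod_0_imp_dvd)
      then show False using int_eq_if_dvd_diff k by blast
    next
      case Partner
      then have "(2 * int i - 2 * int (rw x)) mod int m = column_sum x i k"
        using eq by (auto simp: row_def column_def partner_colour_def split: if_splits)
      then have "int m dvd int i - int k"
        unfolding column_sum_def mod_eq_dvd_iff by (simp add: algebra_simps)
      then show False using int_eq_if_dvd_diff k by blast
    next
      case Spare
      then show False using eq by (auto simp: row_def column_def split: if_splits)
    qed
  qed
  have row_diag: "row (fst u) (snd u) (snd v) \<noteq> diag_colour m n u w"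
    if cells: "u \<in> queen_cells m n" "v \<in> queen_cells m n" "w \<in> queen_cells m n"
      and uv: "snd u \<noteq> snd v" "diagonal u w" for u v w
  proof
    assume eq: "row (fst u) (snd u) (snd v) = diag_colour m n u w"
    have range: "fst u < m" "fst w < m" "snd u < n" "snd v < n" "fst u \<noteq> fst w"
      using cells uv by (auto simp: queen_cells_def diagonal_def)
    obtain d up b where d: "diag_colour m n u w = B d up b"
      using diag_colour_range[OF \<open>odd m\<close> range(1,2,5)] by blast
    then have "K (fst u) (snd u) (snd v) = Spare"
      using eq by (auto simp: row_def partner_colour_def split: line_colour.splits)
    then show False
      using spare[OF range(3,4) uv(1)] eq diag_colour_left[OF m cells(1,3) uv(2)]
      by (simp add: row_def)
  qed
  have column_diag: "column (snd u) (fst u) (fst v) \<noteq> diag_colour m n u w"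
    if cells: "u \<in> queen_cells m n" "v \<in> queen_cells m n" "w \<in> queen_cells m n"
      and uw: "diagonal u w" for u v w
  proof
    assume eq: "column (snd u) (fst u) (fst v) = diag_colour m n u w"
    have range: "fst u < m" "fst w < m" "snd u < n" "fst u \<noteq> fst w"
      using cells uw by (auto simp: queen_cells_def diagonal_def)
    obtain d up b where d: "diag_colour m n u w = B d up b"
      using diag_colour_range[OF \<open>odd m\<close> range(1,2,4)] by blast
    then have "\<not> snd u < 2 * N" "diag_colour m n u w = B (int D) False False"
      using eq by (auto simp: column_def split: if_splits)
    then show False
      using diag_colour_right[OF cells(1,3) uw] range(3) n by auto
  qed
  have proper: "v = w" if uv: "{u, v} \<in> queen_edges m n" and uw: "{u, w} \<in> queen_edges m n"
    and eq: "f u v = f u w" for u v w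
  proof -
    have cells: "u \<in> queen_cells m n" "v \<in> queen_cells m n" "w \<in> queen_cells m n"
      and adj: "queen_adj u v" "queen_adj u w"
      using uv uw by (auto simp: queen_edge_iff)
    have range: "fst u < m" "fst v < m" "fst w < m" "snd u < n" "snd v < n" "snd w < n"
      using cells by (auto simp: queen_cells_def)
    show ?thesis
      using adj(1)
    proof (cases rule: queen_adj_cases)
      case row
      show ?thesis
        using adj(2)
      proof (cases rule: queen_adj_cases)
        case uw: row
        show ?thesis
          using row_proper[of "snd u" "snd v" "snd w" "fst u"] row uw range eq
          by (intro prod_eqI) (simp_all add: f_def)
      next
        case column
        then show ?thesis
          using row_column[of "snd u" "snd v" "fst u" "fst w"] row range eq by (simp add: f_def)
      next
        case diagonal
        then show ?thesis
          using row_diag[OF cells row(2)] row eq by (simp add: f_def)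
      qed
    next
      case column
      show ?thesis
        using adj(2)
      proof (cases rule: queen_adj_cases)
        case row
        then show ?thesis
          using row_column[of "snd u" "snd w" "fst u" "fst v"] column range eq by (simp add: f_def)
      next
        case uw: column
        show ?thesis
          using column_proper[of "fst v" "fst w" "snd u" "fst u"] column uw range eq
          by (intro prod_eqI) (simp_all add: f_def)
      next
        case diagonal
        then show ?thesis
          using column_diag[OF cells] column eq by (simp add: f_def)
      qed
    next
      case diagonal
      show ?thesis
        using adj(2)
      proof (cases rule: queen_adj_cases)
        case row
        then show ?thesis
          using row_diag[OF cells(1,3,2)] diagonal eq by (simp add: f_def)
      next
        case column
        then show ?thesis
          using column_diag[OF cells(1,3,2)] diagonal eq by (simp add: f_def)
      next
        case uw: diagonal
        then show ?thesis
          using diag_colour_proper[OF \<open>odd m\<close> cells diagonal(1) uw(1)] diagonal eq by (simp add: f_def)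
      qed
    qed
  qed
  have B_in_C: "B d up b \<in> C" if "1 \<le> d" "d \<le> int D" for d up b
    using that by (auto simp: C_def image_iff)
  have palette: "f u v \<in> C" if uv: "{u, v} \<in> queen_edges m n" for u v
  proof -
    have adj: "queen_adj u v" and range: "fst u < m" "fst v < m" "snd u < n" "snd v < n"
      using uv by (auto simp: queen_edge_iff queen_cells_def)
    have D: "1 \<le> int D" using \<open>1 \<le> D\<close> by simp
    show ?thesis
      using adj
    proof (cases rule: queen_adj_cases)
      case row
      show ?thesis
      proof (cases "K (fst u) (snd u) (snd v)")
        case (Hue q)
        then show ?thesis
          using K_range[OF range(3,4) row(2) Hue] row(1) n by (auto simp: f_def row_def C_def)
      next
        case Partner
        let ?k = "(2 * int (fst u) - 2 * int (rw (snd u))) mod int m"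
        have "?k \<noteq> 0"
          using nonzero[OF range(1) rw] partner[OF range(3,4) row(2) Partner] by metis
        moreover have "0 \<le> ?k" "?k < int m" using \<open>0 < m\<close> by simp_all
        ultimately show ?thesis
          using Partner row(1) by (auto simp: f_def row_def partner_colour_def C_def)
      next
        case Spare
        then show ?thesis using row(1) B_in_C[OF D] by (simp add: f_def row_def)
      qed
    next
      case column
      have "0 \<le> column_sum (snd u) (fst u) (fst v)" "column_sum (snd u) (fst u) (fst v) < int m"
        using \<open>0 < m\<close> by (simp_all add: column_sum_def)
      then have "column (snd u) (fst u) (fst v) \<in> C"
        using B_in_C[OF D] n by (auto simp: column_def C_def)
      then show ?thesis using column by (simp add: f_def)
    next
      case diagonal
      obtain d up b where "diag_colour m n u v = B d up b" "1 \<le> d" "2 * d < int m"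
        using diag_colour_range[OF \<open>odd m\<close> range(1,2) diagonal(2)] by blast
      then show ?thesis using diagonal B_in_C[of d] m by (simp add: f_def)
    qed
  qed
  have sym: "f u v = f v u" if uv: "{u, v} \<in> queen_edges m n" for u v
  proof -
    have adj: "queen_adj u v" and range: "fst u < m" "fst v < m" "snd u < n" "snd v < n"
      using uv by (auto simp: queen_edge_iff queen_cells_def)
    show ?thesis
      using adj
    proof (cases rule: queen_adj_cases)
      case row
      then show ?thesis using row_sym[OF range(3,4)] by (simp add: f_def)
    next
      case column
      then show ?thesis using column_sym by (simp add: f_def)
    next
      case diagonal
      then show ?thesis using diag_colour_sym[OF range(1,2) diagonal(2) \<open>odd m\<close>] by (simp add: f_def)
    qed
  qed
  have "finite C" by (simp add: C_def)
  have pairs: "\<exists>u v. e = {u, v}" if "e \<in> queen_edges m n" for e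
    using that by (auto simp: queen_edges_def)
  obtain c where c: "proper_edge_colouring (queen_edges m n) c" "c ` queen_edges m n \<subseteq> {..<card C}"
    by (rule proper_edge_colouring_from_symmetric[OF pairs sym proper palette \<open>finite C\<close>])
  \<comment> \<open>The summands are \<open>n - 1\<close>, \<open>m - 1\<close> and
    \<open>4 * D\<close>, the last being \<open>2 * (m - 1)\<close>.\<close>
  have "card C \<le> card {..<n - 1} + card {1..<int m} + card ({1..int D} \<times> (UNIV :: bool set) \<times> (UNIV :: bool set))"
    unfolding C_def by (intro order_trans[OF card_Un_le] add_mono card_image_le) simp_all
  also have "\<dots> = 3 * m + n - 4"
    using m n by (simp add: card_cartesian_product nat_mult_distrib flip: UNIV_Times_UNIV)
  finally have "c ` queen_edges m n \<subseteq> {..<3 * m + n - 4}"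
    using c(2) by auto
  with c(1) show thesis by (rule that)
qed

section \<open>Choice of the parameters\<close>

theorem theorem7:
  fixes m n :: nat
  assumes "odd m" and "odd n"
    and "m \<le> n"
    and "real n \<le> (real m ^ 2 - 3 * real m + 2) / 2"
  shows "class_1 (queen_cells m n) (queen_edges m n)"
proof -
  obtain D where m: "m = 2 * D + 1" using assms(1) by (rule oddE)
  obtain N where n: "n = 2 * N + 1" using assms(2) by (rule oddE)
  have "real (2 * n + 3 * m) \<le> real (m * m + 2)"
    using assms(4) by (simp add: power2_eq_square field_simps)
  then have "2 * n + 3 * m \<le> m * m + 2" by linarith
  then have bound: "4 * N + 3 * m \<le> m * m" using n by simp
  have "N \<ge> D" using assms(3) m n by simp
  \<comment> \<open>For \<open>m = 1\<close> and \<open>m = 3\<close> the bounds admit no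
    \<open>n\<close>.\<close>
  have "D \<ge> 2"
  proof (rule ccontr)
    assume "\<not> 2 \<le> D"
    then have "D = 0 \<or> D = 1" by auto
    then show False using bound m \<open>N \<ge> D\<close> by auto
  qed
  \<comment> \<open>\<open>N / m\<close> rounded up: the number of pairs per row when
    \<open>N\<close> pairs are spread over \<open>m\<close> rows.\<close>
  define s where "s = (N + m - 1) div m"
  have s: "N \<le> m * s" "m * s < N + m"
  proof -
    have "N + m - 1 = m * s + (N + m - 1) mod m" by (simp add: s_def)
    moreover have "(N + m - 1) mod m < m" using m by simp
    ultimately show "N \<le> m * s" "m * s < N + m" using m by linarith+
  qed
  have "1 \<le> s" using s(1) \<open>N \<ge> D\<close> \<open>D \<ge> 2\<close> by (cases s) auto
  \<comment> \<open>The upper bound on \<open>n\<close> gives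
    \<open>4 * m * s < 4 * N + 4 * m \<le> m * m + m\<close>, hence \<open>4 * s \<le> m\<close>;
    equality fails because \<open>m\<close> is odd.\<close>
  have "4 * s + 1 \<le> m"
  proof -
    have "m * (4 * s) < m * (m + 1)"
      using s(2) bound by (simp add: algebra_simps)
    then have "4 * s < m + 1" by (simp only: mult_less_cancel1)
    then show ?thesis using m by presburger
  qed
  then have sD: "2 * s \<le> D" using m by simp
  \<comment> \<open>By minimality of \<open>s\<close>, fewer pairs per row would not suffice:
    \<open>m * (s - 1) < N\<close>.\<close>
  have big: "s = 1 \<or> (4 * s + 1) * (s - 1) < N"
  proof -
    have "(4 * s + 1) * (s - 1) \<le> m * (s - 1)"
      using \<open>4 * s + 1 \<le> m\<close> by (rule mult_le_mono1)
    also have "m * (s - 1) < N"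
    proof -
      have "m \<le> m * s" using \<open>1 \<le> s\<close> by simp
      moreover have "m * (s - 1) = m * s - m" by (simp add: diff_mult_distrib2)
      ultimately show ?thesis using s(2) m by linarith
    qed
    finally show ?thesis ..
  qed
  have "2 \<le> N" using \<open>N \<ge> D\<close> \<open>D \<ge> 2\<close> by linarith
  obtain T where T: "distinct_dilates N s T"
    using distinct_dilates_exist[OF \<open>1 \<le> s\<close> \<open>2 \<le> N\<close> big] ..
  have "2 * s \<le> N" using sD \<open>N \<ge> D\<close> by simp
  then have "\<exists>\<kappa>. line_colouring N s i \<kappa>" for i
    by (rule line_colouring_exists[OF \<open>1 \<le> s\<close> _ T])
  then obtain K where K: "\<And>i. line_colouring N s i (K i)" by metis
  obtain c where c: "proper_edge_colouring (queen_edges m n) c"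
    "c ` queen_edges m n \<subseteq> {..<3 * m + n - 4}"
    using queen_colouring[OF m n \<open>1 \<le> s\<close> sD s(1) K] by blast
  show ?thesis
  proof (rule class_1_if_coloured[OF _ _ queen_degree_centre[OF m assms(3)] c])
    show "finite (queen_cells m n)" by (simp add: queen_cells_def)
    show "(D, D) \<in> queen_cells m n" using m assms(3) by (simp add: queen_cells_def)
  qed
qed

end
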